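(* Let $S$ be a finite multiset of $d$-dimensional figures. Let $f_S(n)$ be the number of ways to place all of the figures in $S$ on the (non-toroidal) grid graph $L^d_n$ such that none overlap. Then there exist a positive integer $n_0$ and an integer polynomial $p(x)$ such that $f_S(n)=p(n)$ for all $n\ge n_0$.
   Context: $L^d_n=(P_n)^d$ is the $d$-dimensional grid graph of size $n$, the product of $d$ copies of the path $P_n$ on $n$ vertices; its vertex set is $\{1,\dots,n\}^d\subset\mathbb{Z}^d$. A $d$-dimensional figure is a finite subset of $\mathbb{Z}^d$, up to translation by integer vectors. A placement of a figure on $L^d_n$ is a subset of $\{1,\dots,n\}^d$ representing the figure. Two placed figures overlap if they share a vertex. Repeated copies of the same figure in the multiset $S$ are indistinguishable.
   Formalization: "Integer polynomial" is taken as a rational polynomial with integer values at all integers; integer coefficients fail when copies are indistinguishable: for d=1 and S two single vertices, f_S(n)=n(n-1)/2. *)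

theory Defs
  imports
    "HOL-Analysis.Finite_Cartesian_Product"
    "HOL-Library.Multiset"
    "HOL-Library.FuncSet"
    "HOL-Computational_Algebra.Polynomial"
begin

text \<open>
  Points of the \<open>d\<close>-dimensional integer lattice are elements of \<^typ>\<open>int ^ 'd\<close>, so \<open>d\<close> is
  \<open>CARD('d)\<close>. Placements only refer to the vertices of the grid graph, never to its edges.
\<close>

definition grid :: "nat \<Rightarrow> (int ^ 'd) set" where
  "grid n = {x. \<forall>i. x $ i \<in> {1..int n}}"

definition translation :: "((int ^ 'd) set \<times> (int ^ 'd) set) set" where
  "translation = {(A, B). finite A \<and> finite B \<and> (\<exists>v. B = (\<lambda>x. x + v) ` A)}"

lemma equiv_translation: "equiv {A. finite A} translation"
proof (rule equivI)
  show "refl_on {A. finite A} translation"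
    by (auto simp: refl_on_def translation_def intro: exI[of _ 0])
  show "sym translation"
  proof (rule symI)
    fix A B :: "(int ^ 'd) set"
    assume "(A, B) \<in> translation"
    then obtain v where v: "finite A" "finite B" "B = (\<lambda>x. x + v) ` A"
      by (auto simp: translation_def)
    then have "A = (\<lambda>x. x + (- v)) ` B"
      by (simp add: image_image)
    with v show "(B, A) \<in> translation"
      unfolding translation_def by blast
  qed
  show "trans translation"
  proof (rule transI)
    fix A B C :: "(int ^ 'd) set"
    assume "(A, B) \<in> translation" "(B, C) \<in> translation"
    then obtain v w where v: "finite A" "finite C" "B = (\<lambda>x. x + v) ` A" "C = (\<lambda>x. x + w) ` B"
      by (auto simp: translation_def)
    then have "C = (\<lambda>x. x + (v + w)) ` A"
      by (simp add: image_image add.assoc)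
    with v show "(A, C) \<in> translation"
      unfolding translation_def by blast
  qed
qed (auto simp: translation_def)

text \<open>A figure is the set of all its representatives. The empty figure is allowed.\<close>

definition figures :: "(int ^ 'd) set set set" where
  "figures = {A. finite A} // translation"

definition placement :: "nat \<Rightarrow> (int ^ 'd) set set \<Rightarrow> (int ^ 'd) set \<Rightarrow> bool" where
  "placement n F A \<longleftrightarrow> A \<in> F \<and> A \<subseteq> grid n"

text \<open>
  Copies of a figure are indistinguishable, so a joint placement of \<open>S\<close> is a multiset of placed
  figures that can be matched with \<open>S\<close>. The condition \<open>{#A, B#} \<subseteq># M\<close> says that \<open>A\<close> and \<open>B\<close> are two
  different members of \<open>M\<close>, where \<open>A = B\<close> is possible only if \<open>A\<close> has multiplicity at least two.
\<close>

definition joint_placements :: "nat \<Rightarrow> (int ^ 'd) set set multiset \<Rightarrow> (int ^ 'd) set multiset set" where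
  "joint_placements n S =
     {M. rel_mset (placement n) S M \<and> (\<forall>A B. {#A, B#} \<subseteq># M \<longrightarrow> A \<inter> B = {})}"

text \<open>The cardinality below is that of a finite set.\<close>

lemma finite_grid: "finite (grid n :: (int ^ 'd) set)"
proof -
  have "grid n \<subseteq> vec_lambda ` (UNIV \<rightarrow>\<^sub>E {1..int n} :: ('d \<Rightarrow> int) set)"
  proof
    fix x :: "int ^ 'd"
    assume "x \<in> grid n"
    then have "vec_nth x \<in> UNIV \<rightarrow>\<^sub>E {1..int n}"
      by (auto simp: grid_def)
    then show "x \<in> vec_lambda ` (UNIV \<rightarrow>\<^sub>E {1..int n})"
      by (metis image_eqI vec_lambda_eta vec_nth_inverse)
  qed
  then show ?thesis
    by (rule finite_subset) (auto intro!: finite_imageI finite_PiE)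
qed

lemma finite_joint_placements: "finite (joint_placements n S)"
proof -
  have "joint_placements n S \<subseteq> mset ` {xs. set xs \<subseteq> Pow (grid n) \<and> length xs = size S}"
  proof
    fix M
    assume "M \<in> joint_placements n S"
    then have *: "rel_mset (placement n) S M"
      by (simp add: joint_placements_def)
    obtain xs where xs: "M = mset xs"
      by (metis ex_mset)
    have "A \<subseteq> grid n" if "A \<in># M" for A
    proof -
      obtain As Fs where "mset Fs = S" "mset As = M" "list_all2 (placement n) Fs As"
        using * by (auto simp: rel_mset_def)
      with that show ?thesis
        by (metis in_set_conv_nth list_all2_conv_all_nth placement_def set_mset_mset)
    qed
    then show "M \<in> mset ` {xs. set xs \<subseteq> Pow (grid n) \<and> length xs = size S}"
      using xs rel_mset_size[OF *] by auto
  qed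
  then show ?thesis
    by (rule finite_subset) (simp add: finite_grid finite_lists_length_eq)
qed

definition num_placements :: "(int ^ 'd) set set multiset \<Rightarrow> nat \<Rightarrow> nat" where
  "num_placements S n = card (joint_placements n S)"

text \<open>
  Integer-valued polynomials, such as \<open>x (x - 1) / 2\<close>. Integer coefficients would be too much to
  ask: this example counts the placements of two indistinguishable single vertices for \<open>d = 1\<close>.
\<close>

definition integer_valued :: "rat poly \<Rightarrow> bool" where
  "integer_valued p \<longleftrightarrow> (\<forall>k::int. poly p (of_int k) \<in> \<int>)"

end

theory Submission imports Defs "HOL-Combinatorics.Permutations"
begin

text \<open>
  Number the figures \<open>F\<^sub>0, \<dots>, F\<^sub>k\<^sub>-\<^sub>1\<close> and fix a representative \<open>A\<^sub>i\<close> of each. If no figure is empty,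
  a labelled placement is the same as a family of translation vectors \<open>v\<^sub>i\<close>. The representative
  \<open>A\<^sub>i + v\<^sub>i\<close> lies in the grid iff \<open>v\<^sub>i\<close> lies in a box whose upper bounds grow with \<open>n\<close>, and two placed
  figures are disjoint iff \<open>v\<^sub>j - v\<^sub>i\<close> avoids the finite set of differences \<open>x - y\<close> with \<open>x \<in> A\<^sub>i\<close>,
  \<open>y \<in> A\<^sub>j\<close>. So the labelled count is a count of integer points \<open>v\<close> in a product of growing boxes, subject
  to finitely many conditions \<open>v\<^sub>j \<noteq> v\<^sub>i + \<delta>\<close>.
  
  Such a count is eventually polynomial. Dropping one condition overcounts exactly the points with
  \<open>v\<^sub>j = v\<^sub>i + \<delta>\<close>, and on these \<open>v\<^sub>j\<close> can be eliminated: its box and its conditions become a box and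
  conditions for \<open>v\<^sub>i\<close>. The result is a problem of the same kind with one variable fewer. Without
  conditions the count is a product of box sizes, each eventually a product of linear polynomials in
  \<open>n\<close>. This is \<open>eventually_poly_card_separated_points\<close>; the induction does the bookkeeping of
  inclusion-exclusion over the overlaps, and the elimination step is \<open>card_separated_points_merge\<close>.
  
  Forgetting the labels divides the count by a constant: disjoint nonempty placed figures are
  distinct, so the labellings of one joint placement correspond to the permutations of the positions
  that preserve the list of figures (\<open>card_labelled_placements\<close>). Copies of the empty figure can only
  be placed in one way and are removed beforehand (\<open>num_placements_filter_nonempty\<close>).
  
  Division leaves a rational polynomial that takes integer values at all large natural numbers. Modulo
  \<open>1\<close>, such a polynomial is periodic on the integers, with a common denominator of its coefficients as
  a period, so it is integer-valued everywhere (\<open>integer_valued_if_eventually_Ints\<close>).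
\<close>

section \<open>Eventually polynomial counting functions\<close>

definition eventually_poly :: "(nat \<Rightarrow> nat) \<Rightarrow> bool" where
  "eventually_poly f \<longleftrightarrow> (\<exists>p :: rat poly. \<forall>\<^sub>F n in sequentially. of_nat (f n) = poly p (of_nat n))"

lemma eventually_polyI:
  assumes "\<forall>\<^sub>F n in sequentially. of_nat (f n) = poly p (of_nat n :: rat)"
  shows "eventually_poly f"
  using assms unfolding eventually_poly_def by blast

lemma eventually_poly_const: "eventually_poly (\<lambda>_. c)"
  by (rule eventually_polyI[where p = "[:of_nat c:]"]) simp

lemma eventually_poly_mult:
  assumes "eventually_poly f" "eventually_poly g"
  shows "eventually_poly (\<lambda>n. f n * g n)"
proof -
  obtain p q :: "rat poly"
    where pq: "\<forall>\<^sub>F n in sequentially. of_nat (f n) = poly p (of_nat n)"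
      "\<forall>\<^sub>F n in sequentially. of_nat (g n) = poly q (of_nat n)"
    using assms unfolding eventually_poly_def by blast
  show ?thesis
    by (rule eventually_polyI[where p = "p * q"], use eventually_conj[OF pq] in eventually_elim) simp
qed

lemma eventually_poly_prod:
  assumes "finite A" "\<And>x. x \<in> A \<Longrightarrow> eventually_poly (f x)"
  shows "eventually_poly (\<lambda>n. \<Prod>x\<in>A. f x n)"
  using assms by (induction A rule: finite_induct) (auto intro: eventually_poly_const eventually_poly_mult)

lemma eventually_poly_diff:
  assumes "eventually_poly h" "eventually_poly g" "\<And>n. h n = f n + g n"
  shows "eventually_poly f"
proof -
  obtain p q :: "rat poly"
    where pq: "\<forall>\<^sub>F n in sequentially. of_nat (h n) = poly p (of_nat n)"
      "\<forall>\<^sub>F n in sequentially. of_nat (g n) = poly q (of_nat n)"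
    using assms(1,2) unfolding eventually_poly_def by blast
  show ?thesis
    by (rule eventually_polyI[where p = "p - q"], use eventually_conj[OF pq] in eventually_elim)
      (auto simp: assms(3) algebra_simps)
qed

lemma eventually_poly_cancel:
  assumes "eventually_poly (\<lambda>n. k * f n)" "k > 0"
  shows "eventually_poly f"
proof -
  obtain p :: "rat poly"
    where p: "\<forall>\<^sub>F n in sequentially. of_nat (k * f n) = poly p (of_nat n)"
    using assms unfolding eventually_poly_def by blast
  show ?thesis
    by (rule eventually_polyI[where p = "smult (1 / of_nat k) p"], use p in eventually_elim)
      (use assms(2) in \<open>auto simp: field_simps\<close>)
qed

section \<open>Integer values of rational polynomials\<close>

text \<open>
  A common denominator \<open>D\<close> of the coefficients works, since \<open>x + D m\<close> and \<open>x\<close> are congruent modulo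
  \<open>D\<close>. Integrality of \<open>D p(x)\<close> is proved along with the periodicity because the induction needs it:
  passing from \<open>p\<close> to \<open>a + X p\<close> adds the term \<open>(y - x) p(y)\<close> to the difference, and \<open>y - x\<close> is a
  multiple of \<open>D\<close>.
\<close>

lemma rat_poly_periodic_mod_one:
  fixes p :: "rat poly"
  shows "\<exists>D>0. (\<forall>x::int. of_int D * poly p (of_int x) \<in> \<int>) \<and>
           (\<forall>x m::int. poly p (of_int (x + D * m)) - poly p (of_int x) \<in> \<int>)"
proof (induction p)
  case 0
  show ?case by (rule exI[of _ 1]) auto
next
  case (pCons a p)
  then obtain D :: int where D: "D > 0"
    "\<And>x::int. of_int D * poly p (of_int x) \<in> \<int>"
    "\<And>x m::int. poly p (of_int (x + D * m)) - poly p (of_int x) \<in> \<int>"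
    by blast
  obtain r s :: int where rs: "a = of_int r / of_int s" "s > 0"
    by (metis quotient_of_denom_pos quotient_of_div surj_pair)
  then have sa: "of_int s * a \<in> \<int>" by simp
  show ?case
  proof (intro exI[of _ "D * s"] conjI allI)
    show "D * s > 0" using D rs by simp
    fix x :: int
    have "of_int (D * s) * poly (pCons a p) (of_int x) =
        of_int D * (of_int s * a) + of_int s * of_int x * (of_int D * poly p (of_int x))"
      by (simp add: algebra_simps)
    also have "\<dots> \<in> \<int>"
      by (intro Ints_add Ints_mult sa D(2)) auto
    finally show "of_int (D * s) * poly (pCons a p) (of_int x) \<in> \<int>" .
    fix m :: int
    let ?y = "x + D * (s * m)"
    have "poly (pCons a p) (of_int ?y) - poly (pCons a p) (of_int x) =
        of_int x * (poly p (of_int ?y) - poly p (of_int x))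
        + of_int (s * m) * (of_int D * poly p (of_int ?y))"
      by (simp add: algebra_simps)
    also have "\<dots> \<in> \<int>"
      by (intro Ints_add Ints_mult D(2,3)) auto
    finally show "poly (pCons a p) (of_int (x + D * s * m)) - poly (pCons a p) (of_int x) \<in> \<int>"
      by (simp add: mult.assoc)
  qed
qed

text \<open>
  Shifting an arbitrary integer by a large multiple of the period moves it into the range where the
  values are known to be integers.
\<close>

lemma integer_valued_if_eventually_Ints:
  assumes "\<And>n::nat. n \<ge> n0 \<Longrightarrow> poly p (of_nat n) \<in> \<int>"
  shows "integer_valued p"
  unfolding integer_valued_def
proof
  fix k :: int
  obtain D :: int where D: "D > 0"
    "\<And>x m::int. poly p (of_int (x + D * m)) - poly p (of_int x) \<in> \<int>"
    using rat_poly_periodic_mod_one[of p] by blast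
  \<comment> \<open>The absolute value makes \<open>k + D m \<ge> n0\<close> also for negative \<open>k\<close>.\<close>
  define m where "m = \<bar>k\<bar> + int n0"
  have "1 * m \<le> D * m"
    by (rule mult_right_mono) (use D(1) in \<open>auto simp: m_def\<close>)
  then have "k + D * m \<ge> int n0" by (simp add: m_def)
  then have "poly p (of_int (k + D * m)) \<in> \<int>"
    using assms[of "nat (k + D * m)"] by (simp add: nat_le_iff le_nat_iff)
  from Ints_diff[OF this D(2)[of k m]] show "poly p (of_int k) \<in> \<int>" by simp
qed

section \<open>Points in growing boxes with excluded differences\<close>

definition growing_box :: "int ^ 'd \<Rightarrow> int ^ 'd \<Rightarrow> nat \<Rightarrow> (int ^ 'd) set" where
  "growing_box a b n = {x. \<forall>l. a $ l \<le> x $ l \<and> x $ l \<le> int n + b $ l}"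

lemma growing_box_eq_image:
  "growing_box a b n = vec_lambda ` (\<Pi>\<^sub>E l\<in>UNIV. {a $ l..int n + b $ l})"
proof (intro equalityI subsetI)
  fix x assume "x \<in> growing_box a b n"
  then show "x \<in> vec_lambda ` (\<Pi>\<^sub>E l\<in>UNIV. {a $ l..int n + b $ l})"
    by (intro image_eqI[of _ _ "vec_nth x"]) (auto simp: growing_box_def)
qed (auto simp: growing_box_def PiE_iff)

lemma card_growing_box: "card (growing_box a b n) = (\<Prod>l\<in>UNIV. nat (int n + b $ l - a $ l + 1))"
  unfolding growing_box_eq_image
  by (subst card_image) (auto simp: inj_on_def vec_lambda_inject card_PiE algebra_simps)

lemma finite_growing_box: "finite (growing_box a b n)"
  unfolding growing_box_eq_image by (intro finite_imageI finite_PiE) auto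

lemma eventually_poly_card_growing_box: "eventually_poly (\<lambda>n. card (growing_box a b n))"
  unfolding card_growing_box
proof (rule eventually_poly_prod)
  fix l :: 'a
  \<comment> \<open>The count is only eventually polynomial because short sides are cut off at \<open>0\<close>.\<close>
  let ?c = "b $ l - a $ l + 1"
  have "\<forall>\<^sub>F n in sequentially. n \<ge> nat (- ?c)"
    by (rule eventually_ge_at_top)
  then show "eventually_poly (\<lambda>n. nat (int n + b $ l - a $ l + 1))"
    by (intro eventually_polyI[where p = "[:of_int ?c, 1:]"], eventually_elim) (simp add: of_nat_nat)
qed auto

definition separated_points ::
  "'i set \<Rightarrow> ('i \<Rightarrow> int ^ 'd) \<Rightarrow> ('i \<Rightarrow> int ^ 'd) \<Rightarrow> ('i \<times> 'i \<times> (int ^ 'd)) set \<Rightarrow> nat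
    \<Rightarrow> ('i \<Rightarrow> int ^ 'd) set" where
  "separated_points I a b C n =
     {v \<in> \<Pi>\<^sub>E i\<in>I. growing_box (a i) (b i) n. \<forall>(i, j, \<delta>)\<in>C. v j \<noteq> v i + \<delta>}"

lemma separated_points_iff:
  "v \<in> separated_points I a b C n \<longleftrightarrow>
    (\<forall>i\<in>I. v i \<in> growing_box (a i) (b i) n) \<and> (\<forall>i. i \<notin> I \<longrightarrow> v i = undefined) \<and>
    (\<forall>i j \<delta>. (i, j, \<delta>) \<in> C \<longrightarrow> v j \<noteq> v i + \<delta>)"
  unfolding separated_points_def by (auto simp: PiE_iff extensional_def)

lemma finite_separated_points: "finite I \<Longrightarrow> finite (separated_points I a b C n)"
  unfolding separated_points_def
  by (rule finite_subset[of _ "\<Pi>\<^sub>E i\<in>I. growing_box (a i) (b i) n"])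
    (auto intro!: finite_PiE finite_growing_box)

lemma card_separated_points_insert:
  assumes "k \<notin> I" "C \<subseteq> I \<times> I \<times> UNIV"
  shows "card (separated_points (insert k I) a b C n) =
    card (growing_box (a k) (b k) n) * card (separated_points I a b C n)"
proof -
  have away: "i \<noteq> k" "j \<noteq> k" if "(i, j, \<delta>) \<in> C" for i j \<delta>
    using that assms by auto
  have "bij_betw (\<lambda>(x, v). v(k := x))
      (growing_box (a k) (b k) n \<times> separated_points I a b C n) (separated_points (insert k I) a b C n)"
    by (rule bij_betwI[where g = "\<lambda>v. (v k, v(k := undefined))"])
      (use \<open>k \<notin> I\<close> away in \<open>auto simp: separated_points_iff split: if_splits\<close>)
  from bij_betw_same_card[OF this] show ?thesis by (simp add: card_cartesian_product)
qed

text \<open>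
  The conditions that involve a distinguished point \<open>k\<close>, described by the pairs \<open>(i, \<delta>)\<close> for which
  \<open>v k = v i + \<delta>\<close> is excluded.
\<close>

definition apart_from :: "'i \<Rightarrow> ('i \<times> (int ^ 'd)) set \<Rightarrow> ('i \<times> 'i \<times> (int ^ 'd)) set" where
  "apart_from k T = (\<lambda>(i, \<delta>). (i, k, \<delta>)) ` T"

text \<open>
  Eliminating \<open>v k\<close> by \<open>v k = v i + \<delta>\<close>. The box of \<open>k\<close>, translated by \<open>- \<delta>\<close>, is intersected with that
  of \<open>i\<close>, and a condition \<open>v k \<noteq> v m + \<epsilon>\<close> turns into \<open>v i \<noteq> v m + (\<epsilon> - \<delta>)\<close>. For \<open>m = i\<close> this reads
  \<open>\<delta> \<noteq> \<epsilon>\<close>, which holds because \<open>(i, \<delta>) \<notin> T\<close>, so these conditions disappear and no condition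
  between \<open>i\<close> and itself arises.
\<close>

lemma card_separated_points_merge:
  fixes \<delta> :: "int ^ 'd"
  assumes "k \<notin> I" "i \<in> I" "C \<subseteq> I \<times> I \<times> UNIV" "T \<subseteq> I \<times> UNIV" "(i, \<delta>) \<notin> T"
  shows "card {v \<in> separated_points (insert k I) a b (C \<union> apart_from k T) n. v k = v i + \<delta>} =
    card (separated_points I
      (a(i := \<chi> l. max (a i $ l) (a k $ l - \<delta> $ l))) (b(i := \<chi> l. min (b i $ l) (b k $ l - \<delta> $ l)))
      (C \<union> apart_from i {(m, \<epsilon> - \<delta>) | m \<epsilon>. (m, \<epsilon>) \<in> T \<and> m \<noteq> i}) n)"
    (is "card ?A = card ?B")
proof -
  have box: "w \<in> growing_box (\<chi> l. max (a i $ l) (a k $ l - \<delta> $ l)) (\<chi> l. min (b i $ l) (b k $ l - \<delta> $ l)) n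
    \<longleftrightarrow> w \<in> growing_box (a i) (b i) n \<and> w + \<delta> \<in> growing_box (a k) (b k) n" for w
  proof -
    have "max p (q - d) \<le> x \<and> x \<le> int n + min r (s - d) \<longleftrightarrow>
        (p \<le> x \<and> x \<le> int n + r) \<and> (q \<le> x + d \<and> x + d \<le> int n + s)" for p q r s d x :: int
      by linarith
    then show ?thesis
      unfolding growing_box_def by (simp add: all_conj_distrib[symmetric])
  qed
  have ne: "k \<noteq> i" using assms by auto
  have "bij_betw (\<lambda>w. w(k := w i + \<delta>)) ?B ?A"
  proof (rule bij_betwI[where g = "\<lambda>v. v(k := undefined)"])
    show "(\<lambda>w. w(k := w i + \<delta>)) \<in> ?B \<rightarrow> ?A"
    proof
      fix w assume w: "w \<in> ?B"
      have pi: "w j \<in> growing_box (a j) (b j) n" if "j \<in> I" for j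
        using w that box[of "w i"] by (cases "j = i") (auto simp: separated_points_iff)
      have pk: "w i + \<delta> \<in> growing_box (a k) (b k) n"
        using w assms(2) box[of "w i"] by (auto simp: separated_points_iff)
      have ex: "w j = undefined" if "j \<notin> I" for j using w that by (auto simp: separated_points_iff)
      have c: "w j \<noteq> w m + \<epsilon>" if "(m, j, \<epsilon>) \<in> C" for m j \<epsilon>
        using w that by (auto simp: separated_points_iff)
      have t: "w i + \<delta> \<noteq> w m + \<epsilon>" if "(m, \<epsilon>) \<in> T" for m \<epsilon>
      proof (cases "m = i")
        case True
        then show ?thesis using that assms(5) by auto
      next
        case False
        then have "(m, i, \<epsilon> - \<delta>) \<in> apart_from i {(m, \<epsilon> - \<delta>) | m \<epsilon>. (m, \<epsilon>) \<in> T \<and> m \<noteq> i}"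
          using that by (auto simp: apart_from_def)
        then have "w i \<noteq> w m + (\<epsilon> - \<delta>)"
          using w by (auto simp: separated_points_iff)
        then show ?thesis by (auto simp: algebra_simps)
      qed
      show "w(k := w i + \<delta>) \<in> ?A"
        using pi pk ex c t ne assms
        by (fastforce simp: separated_points_iff apart_from_def split: if_splits)
    qed
    show "(\<lambda>v. v(k := undefined)) \<in> ?A \<rightarrow> ?B"
    proof
      fix v assume v: "v \<in> ?A"
      have pi: "v j \<in> growing_box (a j) (b j) n" if "j \<in> insert k I" for j
        using v that by (auto simp: separated_points_iff)
      have vk: "v k = v i + \<delta>" using v by simp
      have ex: "v j = undefined" if "j \<notin> insert k I" for j using v that by (auto simp: separated_points_iff)
      have c: "v j \<noteq> v m + \<epsilon>" if "(m, j, \<epsilon>) \<in> C" for m j \<epsilon>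
        using v that by (auto simp: separated_points_iff)
      have t: "v i \<noteq> v m + (\<epsilon> - \<delta>)" if "(m, \<epsilon>) \<in> T" for m \<epsilon>
      proof -
        have "(m, k, \<epsilon>) \<in> apart_from k T" using that by (auto simp: apart_from_def)
        then have "v k \<noteq> v m + \<epsilon>"
          using v by (auto simp: separated_points_iff)
        then show ?thesis using vk by (auto simp: algebra_simps)
      qed
      have bi: "v i \<in> growing_box (\<chi> l. max (a i $ l) (a k $ l - \<delta> $ l)) (\<chi> l. min (b i $ l) (b k $ l - \<delta> $ l)) n"
        using pi[of i] pi[of k] vk assms(2) box by auto
      show "v(k := undefined) \<in> ?B"
        using pi bi ex c t ne assms
        by (fastforce simp: separated_points_iff apart_from_def split: if_splits)
    qed
  qed (use ne assms(1) in \<open>auto simp: separated_points_iff fun_eq_iff\<close>)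
  then show ?thesis by (simp add: bij_betw_same_card)
qed

text \<open>
  Two nested inductions: the outer one on the set of points, the inner one on the conditions on the
  newly added point \<open>k\<close>. Removing one of these conditions adds the points counted by
  \<open>card_separated_points_merge\<close>; that count lives on the smaller set \<open>I\<close>, with other boxes and other
  conditions, so the outer induction hypothesis covers it.
\<close>

theorem eventually_poly_card_separated_points:
  fixes a b :: "'i \<Rightarrow> int ^ 'd"
  assumes "finite I" "finite C" "\<And>i j \<delta>. (i, j, \<delta>) \<in> C \<Longrightarrow> i \<in> I \<and> j \<in> I \<and> i \<noteq> j"
  shows "eventually_poly (\<lambda>n. card (separated_points I a b C n))"
  using assms
proof (induction I arbitrary: a b C rule: finite_induct)
  case empty
  then have "C = {}" by auto
  then show ?case by (simp add: separated_points_def eventually_poly_const)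
next
  case (insert k I)
  define C0 where "C0 = C \<inter> (I \<times> I \<times> UNIV)"
  have C0: "finite C0" "\<And>i j \<delta>. (i, j, \<delta>) \<in> C0 \<Longrightarrow> i \<in> I \<and> j \<in> I \<and> i \<noteq> j" "C0 \<subseteq> I \<times> I \<times> UNIV"
    using insert.prems by (auto simp: C0_def)
  note IH = insert.IH
  have main: "eventually_poly (\<lambda>n. card (separated_points (insert k I) a b (C0 \<union> apart_from k T) n))"
    if "finite T" "T \<subseteq> I \<times> UNIV" for T
    using that
  proof (induction T rule: finite_induct)
    case empty
    show ?case
      unfolding apart_from_def
      by (simp add: card_separated_points_insert[OF insert.hyps(2) C0(3)])
        (intro eventually_poly_mult eventually_poly_card_growing_box insert.IH C0(1,2))
  next
    case (insert p T)
    obtain i \<delta> where p: "p = (i, \<delta>)" by fastforce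
    have i: "i \<in> I" and T: "T \<subseteq> I \<times> UNIV" "(i, \<delta>) \<notin> T" "finite T" using insert p by auto
    let ?sep = "\<lambda>T n. separated_points (insert k I) a b (C0 \<union> apart_from k T) n"
    let ?M = "{(m, \<epsilon> - \<delta>) | m \<epsilon>. (m, \<epsilon>) \<in> T \<and> m \<noteq> i}"
    have finM: "finite ?M"
      by (rule finite_subset[OF _ finite_imageI[OF T(3), of "\<lambda>(m, \<epsilon>). (m, \<epsilon> - \<delta>)"]]) auto
    have merged: "eventually_poly (\<lambda>n. card {v \<in> ?sep T n. v k = v i + \<delta>})"
      unfolding card_separated_points_merge[OF \<open>k \<notin> I\<close> i C0(3) T(1,2)]
      by (rule IH)
         (use C0 finM T i in \<open>auto simp: apart_from_def\<close>)
    show ?case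
    proof (rule eventually_poly_diff[OF insert.IH[OF T(1)] merged])
      fix n
      have "?sep T n = ?sep (insert p T) n \<union> {v \<in> ?sep T n. v k = v i + \<delta>}"
        by (auto simp: separated_points_def apart_from_def p)
      moreover have "?sep (insert p T) n \<inter> {v \<in> ?sep T n. v k = v i + \<delta>} = {}"
        by (auto simp: separated_points_def apart_from_def p)
      moreover have "finite (?sep T n)" for T
        using \<open>finite I\<close> by (simp add: finite_separated_points)
      ultimately show "card (?sep T n) = card (?sep (insert p T) n) + card {v \<in> ?sep T n. v k = v i + \<delta>}"
        by (metis (no_types, lifting) card_Un_disjoint finite_Un)
    qed
  qed
  \<comment> \<open>Conditions in which \<open>k\<close> comes first are turned around, which negates the difference.\<close>
  define T where "T = {(i, \<delta>). (i, k, \<delta>) \<in> C \<or> (k, i, - \<delta>) \<in> C}"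
  have "T \<subseteq> (\<lambda>(i, j, \<delta>). (i, \<delta>)) ` C \<union> (\<lambda>(i, j, \<delta>). (j, - \<delta>)) ` C"
    by (force simp: T_def)
  then have "finite T" by (rule finite_subset) (use insert.prems in auto)
  have "T \<subseteq> I \<times> UNIV" using insert.prems by (auto simp: T_def)
  have "separated_points (insert k I) a b C n = separated_points (insert k I) a b (C0 \<union> apart_from k T) n" for n
  proof -
    have "(\<forall>(i, j, \<delta>)\<in>C. v j \<noteq> v i + \<delta>) \<longleftrightarrow> (\<forall>(i, j, \<delta>)\<in>C0 \<union> apart_from k T. v j \<noteq> v i + \<delta>)" for v
    proof
      assume L: "\<forall>(i, j, \<delta>)\<in>C. v j \<noteq> v i + \<delta>"
      have "v k \<noteq> v i + \<delta>" if "(i, \<delta>) \<in> T" for i \<delta>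
        using that L by (force simp: T_def)
      then show "\<forall>(i, j, \<delta>)\<in>C0 \<union> apart_from k T. v j \<noteq> v i + \<delta>"
        using L by (auto simp: C0_def apart_from_def)
    next
      assume R: "\<forall>(i, j, \<delta>)\<in>C0 \<union> apart_from k T. v j \<noteq> v i + \<delta>"
      have t: "v k \<noteq> v i + \<delta>" if "(i, \<delta>) \<in> T" for i \<delta>
        using that R by (force simp: apart_from_def)
      show "\<forall>(i, j, \<delta>)\<in>C. v j \<noteq> v i + \<delta>"
      proof clarify
        fix i j \<delta> assume c: "(i, j, \<delta>) \<in> C" and e: "v j = v i + \<delta>"
        from insert.prems(2)[OF c] consider "i \<in> I" "j \<in> I" | "j = k" | "i = k" by auto
        then show False
        proof cases
          case 1
          then show False using bspec[OF R, of "(i, j, \<delta>)"] c e by (simp add: C0_def)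
        next
          case 2
          then show False using t[of i \<delta>] c e by (auto simp: T_def)
        next
          case 3
          then show False using t[of j "- \<delta>"] c e by (auto simp: T_def)
        qed
      qed
    qed
    then show ?thesis by (auto simp: separated_points_def)
  qed
  then show ?case using main[OF \<open>finite T\<close> \<open>T \<subseteq> I \<times> UNIV\<close>] by simp
qed

section \<open>Labelled and unlabelled placements\<close>

lemma pair_subseteq_add_mset_iff:
  "{#A, B#} \<subseteq># add_mset X M \<longleftrightarrow> {#A, B#} \<subseteq># M \<or> A = X \<and> B \<in># M \<or> B = X \<and> A \<in># M"
proof (cases "A = X")
  case True
  then show ?thesis
    by (auto simp: insert_subset_eq_iff dest: in_diffD)
next
  case False
  then have "add_mset X M - {#A#} = add_mset X (M - {#A#})" if "A \<in># M"
    using that by simp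
  with False show ?thesis
    by (auto simp: insert_subset_eq_iff)
qed

lemma pairwise_disjoint_mset_iff:
  "(\<forall>A B. {#A, B#} \<subseteq># mset xs \<longrightarrow> A \<inter> B = {}) \<longleftrightarrow> sorted_wrt disjnt xs"
proof (induction xs)
  case (Cons X xs)
  have "(\<forall>A B. {#A, B#} \<subseteq># mset (X # xs) \<longrightarrow> A \<inter> B = {}) \<longleftrightarrow>
      (\<forall>A B. {#A, B#} \<subseteq># mset xs \<longrightarrow> A \<inter> B = {}) \<and> (\<forall>A\<in>set xs. X \<inter> A = {})"
    unfolding mset.simps pair_subseteq_add_mset_iff set_mset_mset by blast
  then show ?case by (simp add: Cons.IH disjnt_def conj_commute)
qed auto

lemma distinct_if_disjoint_nonempty:
  "sorted_wrt disjnt xs \<Longrightarrow> {} \<notin> set xs \<Longrightarrow> distinct xs"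
  by (induction xs) (auto simp: disjnt_def)

definition labelled_placements ::
  "nat \<Rightarrow> (int ^ 'd) set set list \<Rightarrow> (int ^ 'd) set list set" where
  "labelled_placements n Fs = {As. list_all2 (placement n) Fs As \<and> sorted_wrt disjnt As}"

lemma finite_labelled_placements: "finite (labelled_placements n Fs)"
proof (rule finite_subset)
  show "labelled_placements n Fs \<subseteq> {As. set As \<subseteq> Pow (grid n) \<and> length As = length Fs}"
    by (fastforce simp: labelled_placements_def list_all2_conv_all_nth placement_def in_set_conv_nth)
qed (simp add: finite_grid finite_lists_length_eq)

lemma joint_placements_eq_image: "joint_placements n (mset Fs) = mset ` labelled_placements n Fs"
proof (intro equalityI subsetI)
  fix M assume M: "M \<in> joint_placements n (mset Fs)"
  then obtain Gs Bs where "mset Gs = mset Fs" "mset Bs = M" "list_all2 (placement n) Gs Bs"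
    by (auto simp: joint_placements_def rel_mset_def)
  then obtain As where "list_all2 (placement n) Fs As" "mset As = M"
    using list_all2_reorder_left_invariance[of "placement n" Gs Bs Fs] by auto
  with M show "M \<in> mset ` labelled_placements n Fs"
    by (auto simp: joint_placements_def labelled_placements_def pairwise_disjoint_mset_iff)
next
  fix M assume "M \<in> mset ` labelled_placements n Fs"
  then obtain As where "list_all2 (placement n) Fs As" "sorted_wrt disjnt As" "M = mset As"
    by (auto simp: labelled_placements_def)
  then show "M \<in> joint_placements n (mset Fs)"
    unfolding joint_placements_def rel_mset_def
    by (simp only: pairwise_disjoint_mset_iff mem_Collect_eq) blast
qed

lemma figures_eq_if_common_element:
  "F \<in> figures \<Longrightarrow> G \<in> figures \<Longrightarrow> A \<in> F \<Longrightarrow> A \<in> G \<Longrightarrow> F = G"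
  unfolding figures_def using quotient_disj[OF equiv_translation] by blast

lemma figure_eq_range_translates:
  assumes "F \<in> figures"
  obtains A where "finite A" "F = range (\<lambda>v. (\<lambda>x. x + v) ` A)"
proof -
  from assms obtain A where "finite A" "F = translation `` {A}"
    by (auto simp: figures_def quotient_def)
  then have "F = range (\<lambda>v. (\<lambda>x. x + v) ` A)"
    by (auto simp: translation_def)
  with \<open>finite A\<close> show ?thesis by (rule that)
qed

lemma empty_in_figure_iff:
  assumes "F \<in> figures"
  shows "{} \<in> F \<longleftrightarrow> F = {{}}"
proof -
  obtain A where A: "finite A" "F = range (\<lambda>v. (\<lambda>x. x + v) ` A)"
    using figure_eq_range_translates[OF assms] .
  show ?thesis
  proof
    assume "{} \<in> F"
    then have "A = {}" by (auto simp: A)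
    then show "F = {{}}" by (simp add: A)
  qed simp
qed

text \<open>
  The members of \<open>As\<close> are nonempty and disjoint, hence distinct, so every rearrangement of \<open>As\<close> comes
  from a unique permutation \<open>p\<close>. It is a labelled placement iff the figure of each \<open>As ! p i\<close> is
  \<open>Fs ! i\<close>; since different figures are disjoint classes, this means \<open>Fs ! p i = Fs ! i\<close>. The number of
  such \<open>p\<close> depends neither on \<open>As\<close> nor on \<open>n\<close>.
\<close>

lemma card_labelled_fibre:
  assumes Fs: "set Fs \<subseteq> figures - {{{}}}" and As: "As \<in> labelled_placements n Fs"
  shows "card {Bs \<in> labelled_placements n Fs. mset Bs = mset As} =
    card {p. p permutes {..<length Fs} \<and> permute_list p Fs = Fs}"
proof -
  have rel: "list_all2 (placement n) Fs As" and disj: "sorted_wrt disjnt As"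
    and len: "length As = length Fs"
    using As by (auto simp: labelled_placements_def list_all2_lengthD)
  have "{} \<notin> Fs ! i" if "i < length Fs" for i
  proof -
    have "Fs ! i \<in> figures - {{{}}}" using Fs nth_mem[OF that] by (rule subsetD)
    then show ?thesis by (simp add: empty_in_figure_iff)
  qed
  then have "{} \<notin> set As"
    using rel len by (metis in_set_conv_nth list_all2_nthD2 placement_def)
  with disj have dist: "distinct As" by (rule distinct_if_disjoint_nonempty)
  have "bij_betw (\<lambda>p. permute_list p As) {p. p permutes {..<length Fs} \<and> permute_list p Fs = Fs}
      {Bs \<in> labelled_placements n Fs. mset Bs = mset As}" (is "bij_betw ?f ?P ?B")
    unfolding bij_betw_def
  proof (intro conjI equalityI subsetI)
    show "inj_on ?f ?P"
    proof (rule inj_onI)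
      fix p q assume p: "p \<in> ?P" and q: "q \<in> ?P" and eq: "?f p = ?f q"
      show "p = q"
      proof
        fix i
        show "p i = q i"
        proof (cases "i < length Fs")
          case True
          have "?f p ! i = ?f q ! i" using eq by simp
          then have "As ! p i = As ! q i"
            using p q len True by (simp add: permute_list_nth)
          moreover have "p i < length As" "q i < length As"
            using p q True len permutes_in_image[of _ "{..<length Fs}" i] by auto
          ultimately show ?thesis using dist by (simp add: nth_eq_iff_index_eq)
        next
          case False
          then show ?thesis using p q by (simp add: permutes_def)
        qed
      qed
    qed
  next
    fix Bs assume "Bs \<in> ?f ` ?P"
    then obtain p where p: "p permutes {..<length Fs}" "permute_list p Fs = Fs" "Bs = permute_list p As"
      by auto
    have ms: "mset Bs = mset As" using p len by simp
    moreover have "list_all2 (placement n) Fs Bs"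
      using list_all2_permute_list_iff[OF p(1), of "placement n" As] p rel by simp
    moreover have "sorted_wrt disjnt Bs"
      using disj unfolding pairwise_disjoint_mset_iff[symmetric] ms .
    ultimately show "Bs \<in> ?B" by (simp add: labelled_placements_def)
  next
    fix Bs assume B: "Bs \<in> ?B"
    then obtain p where p: "p permutes {..<length Fs}" "permute_list p As = Bs"
      using mset_eq_permutation[of Bs As] len by auto
    have "permute_list p Fs = Fs"
    proof (rule nth_equalityI)
      fix i assume "i < length (permute_list p Fs)"
      then have i: "i < length Fs" and pi: "p i < length Fs"
        using permutes_in_image[OF p(1), of i] by auto
      have "As ! p i \<in> Fs ! p i"
        using rel pi by (auto simp: list_all2_conv_all_nth placement_def)
      moreover have "Bs ! i \<in> Fs ! i"
        using B i by (auto simp: labelled_placements_def list_all2_conv_all_nth placement_def)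
      moreover have "Bs ! i = As ! p i"
        using p(1) i len unfolding p(2)[symmetric] by (simp add: permute_list_nth)
      moreover have "Fs ! i \<in> figures" "Fs ! p i \<in> figures"
        using subsetD[OF Fs nth_mem[OF i]] subsetD[OF Fs nth_mem[OF pi]] by simp_all
      ultimately have "Fs ! p i = Fs ! i"
        by (intro figures_eq_if_common_element) simp_all
      then show "permute_list p Fs ! i = Fs ! i"
        using p(1) i by (simp add: permute_list_nth)
    qed simp
    with p show "Bs \<in> ?f ` ?P" by auto
  qed
  then show ?thesis by (simp add: bij_betw_same_card)
qed

lemma card_labelled_placements:
  assumes "set Fs \<subseteq> figures - {{{}}}"
  shows "card (labelled_placements n Fs) =
    card {p. p permutes {..<length Fs} \<and> permute_list p Fs = Fs} * num_placements (mset Fs) n"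
proof -
  have "card (labelled_placements n Fs) =
      (\<Sum>M\<in>joint_placements n (mset Fs). card {As \<in> labelled_placements n Fs. mset As = M})"
    unfolding joint_placements_eq_image
    using sum.image_gen[OF finite_labelled_placements[of n Fs], of "\<lambda>_. 1::nat" mset] by simp
  also have "\<dots> = (\<Sum>M\<in>joint_placements n (mset Fs).
      card {p. p permutes {..<length Fs} \<and> permute_list p Fs = Fs})"
    by (rule sum.cong) (auto simp: joint_placements_eq_image card_labelled_fibre[OF assms])
  finally show ?thesis by (simp add: num_placements_def)
qed

section \<open>Labelled placements as separated points\<close>

text \<open>
  The vector can be recovered from the translate: translation by \<open>v\<close> changes the sum of the
  \<open>l\<close>-th coordinates by \<open>card A * v $ l\<close>.
\<close>

lemma translates_eq_iff:
  fixes A :: "(int ^ 'd) set"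
  assumes "finite A" "A \<noteq> {}"
  shows "(\<lambda>x. x + v) ` A = (\<lambda>x. x + w) ` A \<longleftrightarrow> v = w"
proof
  assume eq: "(\<lambda>x. x + v) ` A = (\<lambda>x. x + w) ` A"
  have sum: "(\<Sum>x\<in>(\<lambda>x. x + u) ` A. x $ l) = (\<Sum>x\<in>A. x $ l) + int (card A) * u $ l"
    for u :: "int ^ 'd" and l
    by (subst sum.reindex) (auto simp: inj_on_def sum.distrib)
  have "v $ l = w $ l" for l
    using sum[of l v] sum[of l w] eq assms by simp
  then show "v = w" by (simp add: vec_eq_iff)
qed simp

lemma translate_subset_grid_iff:
  fixes A :: "(int ^ 'd) set"
  assumes "finite A" "A \<noteq> {}"
  shows "(\<lambda>x. x + v) ` A \<subseteq> grid n \<longleftrightarrow>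
    v \<in> growing_box (\<chi> l. 1 - Min ((\<lambda>x. x $ l) ` A)) (\<chi> l. - Max ((\<lambda>x. x $ l) ` A)) n"
proof -
  have "(\<lambda>x. x + v) ` A \<subseteq> grid n \<longleftrightarrow> (\<forall>l. (\<forall>x\<in>A. 1 - v $ l \<le> x $ l) \<and> (\<forall>x\<in>A. x $ l \<le> int n - v $ l))"
    unfolding grid_def by (auto simp: algebra_simps)
  also have "\<dots> \<longleftrightarrow> (\<forall>l. 1 - v $ l \<le> Min ((\<lambda>x. x $ l) ` A) \<and> Max ((\<lambda>x. x $ l) ` A) \<le> int n - v $ l)"
    using assms by simp
  also have "\<dots> \<longleftrightarrow> v \<in> growing_box (\<chi> l. 1 - Min ((\<lambda>x. x $ l) ` A)) (\<chi> l. - Max ((\<lambda>x. x $ l) ` A)) n"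
    unfolding growing_box_def by (auto simp: algebra_simps)
  finally show ?thesis .
qed

text \<open>
  Translation vectors of fixed representatives identify labelled placements with separated points:
  the coordinates of a representative determine its box, and \<open>x + v i = y + v j\<close> is excluded for
  \<open>x \<in> A i\<close> and \<open>y \<in> A j\<close>, that is, \<open>v j = v i + (x - y)\<close>.
\<close>

lemma eventually_poly_card_labelled_placements:
  fixes Fs :: "(int ^ 'd) set set list"
  assumes "set Fs \<subseteq> figures - {{{}}}"
  shows "eventually_poly (\<lambda>n. card (labelled_placements n Fs))"
proof -
  let ?k = "length Fs"
  have "\<exists>A. finite A \<and> A \<noteq> {} \<and> Fs ! i = range (\<lambda>v. (\<lambda>x. x + v) ` A)" if "i < ?k" for i
  proof -
    have F: "Fs ! i \<in> figures" "Fs ! i \<noteq> {{}}" using assms that nth_mem by blast+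
    obtain A where A: "finite A" "Fs ! i = range (\<lambda>v. (\<lambda>x. x + v) ` A)"
      using figure_eq_range_translates[OF F(1)] .
    have "A \<noteq> {}" using F(2) A(2) by auto
    with A show ?thesis by blast
  qed
  then obtain A where A: "\<And>i. i < ?k \<Longrightarrow> finite (A i)" "\<And>i. i < ?k \<Longrightarrow> A i \<noteq> {}"
    "\<And>i. i < ?k \<Longrightarrow> Fs ! i = range (\<lambda>v. (\<lambda>x. x + v) ` A i)"
    by metis
  define a where "a i = (\<chi> l. 1 - Min ((\<lambda>x. x $ l) ` A i))" for i
  define b where "b i = (\<chi> l. - Max ((\<lambda>x. x $ l) ` A i))" for i
  define C where "C = (\<Union>j<?k. \<Union>i<j. (\<lambda>(x, y). (i, j, x - y)) ` (A i \<times> A j))"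
  have place: "placement n (Fs ! i) ((\<lambda>x. x + v) ` A i) \<longleftrightarrow> v \<in> growing_box (a i) (b i) n"
    if "i < ?k" for i v n
    using translate_subset_grid_iff[OF A(1,2)[OF that], of v n] A(3)[OF that]
    by (auto simp: placement_def a_def b_def)
  have disj: "disjnt ((\<lambda>x. x + v i) ` A i) ((\<lambda>x. x + v j) ` A j) \<longleftrightarrow>
      (\<forall>x\<in>A i. \<forall>y\<in>A j. v j \<noteq> v i + (x - y))" for v i j
    by (fastforce simp: disjnt_def algebra_simps)
  have C_iff: "(\<forall>(i, j, \<delta>)\<in>C. v j \<noteq> v i + \<delta>) \<longleftrightarrow>
      (\<forall>i j. i < j \<longrightarrow> j < ?k \<longrightarrow> disjnt ((\<lambda>x. x + v i) ` A i) ((\<lambda>x. x + v j) ` A j))" for v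
    unfolding disj C_def by fastforce
  let ?f = "\<lambda>v. map (\<lambda>i. (\<lambda>x. x + v i) ` A i) [0..<?k]"
  have bij: "bij_betw ?f (separated_points {..<?k} a b C n) (labelled_placements n Fs)" for n
    unfolding bij_betw_def
  proof (intro conjI equalityI subsetI)
    show "inj_on ?f (separated_points {..<?k} a b C n)"
    proof (rule inj_onI)
      fix v w assume vw: "v \<in> separated_points {..<?k} a b C n" "w \<in> separated_points {..<?k} a b C n"
        and eq: "?f v = ?f w"
      have "v i = w i" if "i < ?k" for i
      proof -
        have "(\<lambda>x. x + v i) ` A i = (\<lambda>x. x + w i) ` A i" using eq that by simp
        then show ?thesis using translates_eq_iff[OF A(1,2)[OF that]] by blast
      qed
      with vw show "v = w"
        by (intro PiE_ext[of v "{..<?k}" _ w]) (auto simp: separated_points_def)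
    qed
  next
    fix As assume "As \<in> ?f ` separated_points {..<?k} a b C n"
    then show "As \<in> labelled_placements n Fs"
      by (auto simp: separated_points_def labelled_placements_def C_iff place list_all2_conv_all_nth
          sorted_wrt_iff_nth_less PiE_iff)
  next
    fix As assume "As \<in> labelled_placements n Fs"
    then have As: "length As = ?k" "\<And>i. i < ?k \<Longrightarrow> placement n (Fs ! i) (As ! i)" "sorted_wrt disjnt As"
      by (auto simp: labelled_placements_def list_all2_conv_all_nth)
    have "\<exists>u. As ! i = (\<lambda>x. x + u) ` A i" if "i < ?k" for i
    proof -
      have "As ! i \<in> Fs ! i" using As(2)[OF that] by (simp add: placement_def)
      then show ?thesis unfolding A(3)[OF that] by blast
    qed
    then obtain u where u: "\<And>i. i < ?k \<Longrightarrow> As ! i = (\<lambda>x. x + u i) ` A i" by metis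
    let ?v = "restrict u {..<?k}"
    have "As = ?f ?v"
      by (rule nth_equalityI) (auto simp: As(1) u)
    moreover have "?v \<in> separated_points {..<?k} a b C n"
      using As by (auto simp: separated_points_def C_iff sorted_wrt_iff_nth_less simp flip: place u)
    ultimately show "As \<in> ?f ` separated_points {..<?k} a b C n" by blast
  qed
  have "eventually_poly (\<lambda>n. card (separated_points {..<?k} a b C n))"
    by (rule eventually_poly_card_separated_points) (auto simp: C_def A(1))
  then show ?thesis by (simp add: bij_betw_same_card[OF bij])
qed

section \<open>Empty figures and the main result\<close>

text \<open>
  The only placement of the empty figure is the empty set, which is disjoint from everything, itself
  included. Joint placements may therefore contain it repeatedly, and the symmetry count for
  labelled placements would fail for them.
\<close>

lemma num_placements_add_empty_figure: "num_placements (add_mset {{}} S) n = num_placements S n"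
proof -
  have empty: "placement n {{}} A \<longleftrightarrow> A = {}" for A :: "(int ^ 'd) set"
    by (auto simp: placement_def)
  have "joint_placements n (add_mset {{}} S) = add_mset {} ` joint_placements n S"
  proof (intro equalityI subsetI)
    fix M assume M: "M \<in> joint_placements n (add_mset {{}} S)"
    then obtain N where N: "M = add_mset {} N" "rel_mset (placement n) S N"
      using msed_rel_invL[of "placement n" "{{}}" S M] by (auto simp: joint_placements_def empty)
    with M show "M \<in> add_mset {} ` joint_placements n S"
      by (auto simp: joint_placements_def pair_subseteq_add_mset_iff)
  next
    fix M assume "M \<in> add_mset {} ` joint_placements n S"
    then obtain N where N: "M = add_mset {} N" "rel_mset (placement n) S N"
      "\<And>A B. {#A, B#} \<subseteq># N \<Longrightarrow> A \<inter> B = {}"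
      by (auto simp: joint_placements_def)
    have "rel_mset (placement n) (add_mset {{}} S) M"
      unfolding N(1) by (rule rel_mset_Plus[OF _ N(2)]) (simp add: empty)
    moreover have "A \<inter> B = {}" if "{#A, B#} \<subseteq># M" for A B
      using that N(3)[of A B] unfolding N(1) pair_subseteq_add_mset_iff by blast
    ultimately show "M \<in> joint_placements n (add_mset {{}} S)"
      by (simp add: joint_placements_def)
  qed
  then show ?thesis
    by (simp add: num_placements_def card_image inj_on_def)
qed

lemma num_placements_filter_nonempty:
  "num_placements (filter_mset (\<lambda>F. F \<noteq> {{}}) S) n = num_placements S n"
proof -
  have "num_placements (replicate_mset m {{}} + T) n = num_placements T n"
    for m and T :: "(int ^ 'd) set set multiset"
    by (induction m) (auto simp: num_placements_add_empty_figure)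
  then show ?thesis
    by (metis multiset_partition filter_eq_replicate_mset add.commute)
qed

text \<open>
  The number of symmetries of the list of nonempty figures is positive, as the identity is one of
  them, so it can be cancelled from the labelled count. The resulting polynomial agrees with the
  number of joint placements at all large \<open>n\<close>, and that number is an integer.
\<close>

theorem theorem5p3:
  fixes S :: "(int ^ 'd) set set multiset"
  assumes "set_mset S \<subseteq> figures"
  shows "\<exists>n0 p. n0 > 0 \<and> integer_valued p \<and>
           (\<forall>n\<ge>n0. of_nat (num_placements S n) = poly p (of_nat n))"
proof -
  obtain Fs where Fs: "mset Fs = filter_mset (\<lambda>F. F \<noteq> {{}}) S"
    using ex_mset by blast
  then have "set Fs = set_mset (filter_mset (\<lambda>F. F \<noteq> {{}}) S)"
    by (metis set_mset_mset)
  with assms have sub: "set Fs \<subseteq> figures - {{{}}}" by auto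
  let ?P = "{p. p permutes {..<length Fs} \<and> permute_list p Fs = Fs}"
  have "id \<in> ?P" by (simp add: permutes_id)
  moreover have "finite ?P"
    by (rule finite_subset[of _ "{p. p permutes {..<length Fs}}"]) (auto simp: finite_permutations)
  ultimately have "card ?P > 0" using card_gt_0_iff[of ?P] by blast
  with eventually_poly_card_labelled_placements[OF sub]
  have "eventually_poly (num_placements (mset Fs))"
    unfolding card_labelled_placements[OF sub] by (rule eventually_poly_cancel)
  then have "eventually_poly (num_placements S)"
    by (simp add: Fs num_placements_filter_nonempty eventually_poly_def)
  then obtain p :: "rat poly" and n1
    where p: "\<And>n. n \<ge> n1 \<Longrightarrow> of_nat (num_placements S n) = poly p (of_nat n)"
    by (auto simp: eventually_poly_def eventually_sequentially)
  have "integer_valued p"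
    by (rule integer_valued_if_eventually_Ints[of n1]) (simp flip: p)
  with p show ?thesis by (intro exI[of _ "Suc n1"] exI[of _ p]) auto
qed

end
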